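(* Each of the two greedy heuristics greedy-longest and greedy-shortest has worst-case approximation ratio $\Omega(m/\log m)$ for $\mathrm{MFD}_{\mathbb N}$ on sparse graphs. That is, for each of the two heuristics there exist constants $c, C>0$ and an infinite family of instances $(G,X)$, where $G=(V,E)$ is an $s$-$t$ DAG with $m=|E|\le C\,|V|$ and $m$ unbounded over the family, and $X\colon E\to\mathbb N$ is a flow, such that on each instance of the family the number of paths used by the heuristic to decompose $X$ is at least $c\cdot\frac{m}{\log m}\cdot \mathrm{mfd}_{\mathbb N}(G,X)$.
   Context: An $s$-$t$ DAG is a directed acyclic graph $G=(V,E)$ with a unique source $s$ (no in-edges) and a unique sink $t$ (no out-edges). A flow is a function $X$ on $E$ such that at every node of $V\setminus\{s,t\}$ incoming flow equals outgoing flow. An $s$-$t$ path $P$ is identified with the flow that is $1$ on the edges of $P$ and $0$ elsewhere. A flow decomposition of $(G,X)$ of size $k$ with weights in $\mathbb N$ ($0\in\mathbb N$) is a family of $s$-$t$ paths $P_1,\dots,P_k$ with weights $w_1,\dots,w_k\in\mathbb N$ such that $X=w_1P_1+\dots+w_kP_k$; $\mathrm{mfd}_{\mathbb N}(G,X)$ is the smallest size of such a decomposition, and $\mathrm{MFD}_{\mathbb N}$ is the problem of finding one of smallest size. Greedy-longest (respectively greedy-shortest) is the algorithm that, starting from $X$, repeatedly picks an $s$-$t$ path with the largest (respectively smallest) number of edges among the $s$-$t$ paths all of whose edges have positive remaining flow (ties broken arbitrarily), adds it to the decomposition with the maximum possible weight, i.e. the minimum remaining flow over its edges, and subtracts this weight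 from the remaining flow on each of its edges, until the remaining flow is $0$. *)

theory Defs
  imports Complex_Main "Graph_Theory.Pair_Digraph"
begin

text \<open>
  Graphs are simple: an edge is the pair of its endpoints, so there are no parallel edges.
\<close>

definition st_dag :: "'a pair_pre_digraph \<Rightarrow> 'a \<Rightarrow> 'a \<Rightarrow> bool" where
  "st_dag G s t \<longleftrightarrow> pair_digraph G \<and> acyclic (parcs G) \<and>
     {v \<in> pverts G. in_arcs G v = {}} = {s} \<and>
     {v \<in> pverts G. out_arcs G v = {}} = {t}"

text \<open>
  Edge functions are total on pairs of vertices; only their values on \<^term>\<open>parcs G\<close> matter.
\<close>

definition flow :: "'a pair_pre_digraph \<Rightarrow> 'a \<Rightarrow> 'a \<Rightarrow> ('a \<times> 'a \<Rightarrow> nat) \<Rightarrow> bool" where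
  "flow G s t X \<longleftrightarrow>
     (\<forall>v \<in> pverts G - {s, t}. (\<Sum>e \<in> in_arcs G v. X e) = (\<Sum>e \<in> out_arcs G v. X e))"

abbreviation st_path :: "'a pair_pre_digraph \<Rightarrow> 'a \<Rightarrow> 'a \<Rightarrow> ('a \<times> 'a) list \<Rightarrow> bool" where
  "st_path G s t p \<equiv> pre_digraph.apath (with_proj G) s p t"

definition path_flow :: "('a \<times> 'a) list \<Rightarrow> 'a \<times> 'a \<Rightarrow> nat" where
  "path_flow p e = (if e \<in> set p then 1 else 0)"

text \<open>
  A decomposition is a list of weighted paths, so a path may occur repeatedly and a weight
  may be zero; its size is the length of the list.
\<close>

definition flow_decomposition ::
  "'a pair_pre_digraph \<Rightarrow> 'a \<Rightarrow> 'a \<Rightarrow> ('a \<times> 'a \<Rightarrow> nat) \<Rightarrow> (nat \<times> ('a \<times> 'a) list) list \<Rightarrow> bool"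
where
  "flow_decomposition G s t X D \<longleftrightarrow>
     (\<forall>(w, p) \<in> set D. st_path G s t p) \<and>
     (\<forall>e \<in> parcs G. X e = (\<Sum>(w, p) \<leftarrow> D. w * path_flow p e))"

text \<open>
  Every flow with natural values on an s-t DAG has a decomposition, so for those the minimum
  is attained.
\<close>

definition mfd :: "'a pair_pre_digraph \<Rightarrow> 'a \<Rightarrow> 'a \<Rightarrow> ('a \<times> 'a \<Rightarrow> nat) \<Rightarrow> nat" where
  "mfd G s t X = (LEAST k. \<exists>D. flow_decomposition G s t X D \<and> length D = k)"

definition positive_path ::
  "'a pair_pre_digraph \<Rightarrow> 'a \<Rightarrow> 'a \<Rightarrow> ('a \<times> 'a \<Rightarrow> nat) \<Rightarrow> ('a \<times> 'a) list \<Rightarrow> bool"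
where
  "positive_path G s t Y p \<longleftrightarrow> st_path G s t p \<and> (\<forall>e \<in> set p. 0 < Y e)"

text \<open>
  \<open>greedy_run choice G s t Y D\<close>: started from the remaining flow \<open>Y\<close>, the algorithm
  that in each round takes a path \<open>p\<close> with \<open>choice (positive_path G s t Y) p\<close> can output
  the decomposition \<open>D\<close>. It is a relation because ties are broken arbitrarily. The natural
  number subtraction never truncates, as the weight is at most the remaining flow on the path.
\<close>

inductive greedy_run ::
  "((('a \<times> 'a) list \<Rightarrow> bool) \<Rightarrow> ('a \<times> 'a) list \<Rightarrow> bool) \<Rightarrow> 'a pair_pre_digraph \<Rightarrow> 'a \<Rightarrow> 'a \<Rightarrow>
   ('a \<times> 'a \<Rightarrow> nat) \<Rightarrow> (nat \<times> ('a \<times> 'a) list) list \<Rightarrow> bool"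
  for choice G s t
where
  finish: "\<forall>e \<in> parcs G. Y e = 0 \<Longrightarrow> greedy_run choice G s t Y []"
| step: "\<lbrakk>\<exists>e \<in> parcs G. Y e \<noteq> 0; choice (positive_path G s t Y) p; w = Min (Y ` set p);
    greedy_run choice G s t (\<lambda>e. Y e - w * path_flow p e) D\<rbrakk>
    \<Longrightarrow> greedy_run choice G s t Y ((w, p) # D)"

definition greedy_longest ::
  "'a pair_pre_digraph \<Rightarrow> 'a \<Rightarrow> 'a \<Rightarrow> ('a \<times> 'a \<Rightarrow> nat) \<Rightarrow> (nat \<times> ('a \<times> 'a) list) list \<Rightarrow> bool"
where
  "greedy_longest = greedy_run (is_arg_max length)"

definition greedy_shortest ::
  "'a pair_pre_digraph \<Rightarrow> 'a \<Rightarrow> 'a \<Rightarrow> ('a \<times> 'a \<Rightarrow> nat) \<Rightarrow> (nat \<times> ('a \<times> 'a) list) list \<Rightarrow> bool"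
where
  "greedy_shortest = greedy_run (is_arg_min length)"

end

theory Submission
  imports Defs
begin

text \<open>
  The instance is a chain of \<open>n = 2 ^ k - 1\<close> stages. In stage \<open>j < n\<close> the flow, of value \<open>n\<close>,
  splits between the arc \<open>(2 j, 2 j + 2)\<close> and the detour through \<open>2 j + 1\<close>: the route that the
  heuristic prefers (the detour for greedy-longest, the arc for greedy-shortest) carries \<open>j\<close>
  units and the other route \<open>n - j\<close>.
  After \<open>r\<close> rounds the preferred routes carry \<open>j - r\<close> units; the heuristic then must use exactly
  the preferred routes of the stages \<open>j > r\<close>, and stage \<open>r + 1\<close> limits the weight to 1. Hence it
  outputs \<open>n\<close> paths. On the other hand, the binary digits of the numbers \<open>j < 2 ^ k\<close> give a
  decomposition into \<open>k\<close> paths with weights \<open>2 ^ i\<close>.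
\<close>

section \<open>The chain, its paths and the flow left after each round\<close>

definition chain :: "nat \<Rightarrow> nat pair_pre_digraph" where
  "chain n = \<lparr>pverts = {..2 * n},
     parcs = {(u, v). u < 2 * n \<and> (v = Suc u \<or> even u \<and> v = u + 2)}\<rparr>"

text \<open>\<open>b\<close> is true for greedy-longest and false for greedy-shortest.\<close>

definition preferred :: "bool \<Rightarrow> nat \<times> nat \<Rightarrow> bool" where
  "preferred b e \<longleftrightarrow> (snd e \<noteq> fst e + 2) = b"

definition stage :: "nat \<times> nat \<Rightarrow> nat" where
  "stage e = fst e div 2"

definition stage_route :: "bool \<Rightarrow> nat \<Rightarrow> (nat \<times> nat) list" where
  "stage_route d j =
     (if d then [(2 * j, 2 * j + 1), (2 * j + 1, 2 * j + 2)] else [(2 * j, 2 * j + 2)])"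

text \<open>\<open>P\<close> is the set of stages in which the preferred route is taken; comparing
  membership with \<open>b\<close> turns this into detour or direct arc. The start stage
  \<open>i\<close> is variable for the sake of downward induction.\<close>

definition chain_path :: "bool \<Rightarrow> nat \<Rightarrow> nat \<Rightarrow> nat set \<Rightarrow> (nat \<times> nat) list" where
  "chain_path b i n P = concat (map (\<lambda>j. stage_route ((j \<in> P) = b) j) [i..<n])"

text \<open>Every stage carries \<open>n - r\<close> units in total. The other route of stage
  \<open>j\<close> is used only from round \<open>j\<close> on (counting from 0), so it keeps
  \<open>n - j\<close> units until then and \<open>n - r\<close> afterwards; hence the
  maximum.\<close>

definition remaining :: "bool \<Rightarrow> nat \<Rightarrow> nat \<Rightarrow> nat \<times> nat \<Rightarrow> nat" where
  "remaining b n r e = (if preferred b e then stage e - r else n - max (stage e) r)"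

section \<open>The chain as an s-t DAG carrying a flow\<close>

lemma parcs_chain: "(u, v) \<in> parcs (chain n) \<longleftrightarrow> u < 2 * n \<and> (v = Suc u \<or> even u \<and> v = u + 2)"
  by (simp add: chain_def)

lemma pverts_chain: "pverts (chain n) = {..2 * n}"
  by (simp add: chain_def)

lemma stage_less: "e \<in> parcs (chain n) \<Longrightarrow> stage e < n"
  by (cases e) (auto simp: parcs_chain stage_def)

lemma pair_digraph_chain: "pair_digraph (chain n)"
proof
  have "parcs (chain n) \<subseteq> {..2 * n} \<times> {..2 * n}"
    by (auto simp: parcs_chain elim!: evenE)
  then show "finite (parcs (chain n))"
    by (rule finite_subset) simp
qed (auto simp: parcs_chain pverts_chain elim!: evenE)

lemma card_parcs_chain: "card (parcs (chain n)) = 3 * n"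
proof -
  have "parcs (chain n) = (\<lambda>u. (u, Suc u)) ` {..<2 * n} \<union> (\<lambda>j. (2 * j, 2 * j + 2)) ` {..<n}"
    by (auto simp: chain_def elim!: evenE)
  also have "card \<dots> = card ((\<lambda>u. (u, Suc u)) ` {..<2 * n}) + card ((\<lambda>j. (2 * j, 2 * j + 2)) ` {..<n})"
    by (rule card_Un_disjoint) auto
  also have "\<dots> = 3 * n"
    by (simp add: card_image inj_on_def)
  finally show ?thesis .
qed

lemma in_arcs_chain:
  "in_arcs (chain n) v = {e \<in> parcs (chain n). snd e = v}"
  "out_arcs (chain n) v = {e \<in> parcs (chain n). fst e = v}"
  by (auto simp: in_arcs_def out_arcs_def)

lemma st_dag_chain:
  assumes "0 < n"
  shows "st_dag (chain n) 0 (2 * n)"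
proof -
  have "parcs (chain n) \<subseteq> less_than"
    by (auto simp: parcs_chain)
  then have "acyclic (parcs (chain n))"
    using acyclic_subset wf_acyclic wf_less_than by blast
  moreover have "in_arcs (chain n) 0 = {}" "out_arcs (chain n) (2 * n) = {}"
    by (auto simp: in_arcs_chain parcs_chain)
  moreover have "(v - 1, v) \<in> in_arcs (chain n) v" if "v \<le> 2 * n" "v \<noteq> 0" for v
    using that by (auto simp: in_arcs_chain parcs_chain)
  moreover have "(v, Suc v) \<in> out_arcs (chain n) v" if "v \<le> 2 * n" "v \<noteq> 2 * n" for v
    using that by (auto simp: in_arcs_chain parcs_chain)
  ultimately show ?thesis
    unfolding st_dag_def using pair_digraph_chain
    by (fastforce simp: pverts_chain)
qed

text \<open>The two routes of stage \<open>j\<close> carry \<open>j\<close> and \<open>n - j\<close>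
  units in some order, so all stages have the same total \<open>n\<close>; an odd vertex only passes
  on the flow of its detour.\<close>

lemma flow_chain: "flow (chain n) 0 (2 * n) (remaining b n 0)"
  unfolding flow_def
proof
  fix v assume "v \<in> pverts (chain n) - {0, 2 * n}"
  then have v: "0 < v" "v < 2 * n"
    by (auto simp: pverts_chain)
  show "(\<Sum>e\<in>in_arcs (chain n) v. remaining b n 0 e) = (\<Sum>e\<in>out_arcs (chain n) v. remaining b n 0 e)"
  proof (cases "even v")
    case True
    with v obtain i where i: "v = 2 * Suc i" "Suc i < n"
      by (metis evenE nat_0_less_mult_iff gr0_implies_Suc nat_mult_less_cancel1)
    have "in_arcs (chain n) v = {(2 * i, 2 * i + 2), (2 * i + 1, 2 * i + 2)}"
      using i by (auto simp: in_arcs_chain parcs_chain)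
    moreover have "out_arcs (chain n) v = {(v, v + 2), (v, v + 1)}"
      using i by (auto simp: in_arcs_chain parcs_chain)
    ultimately show ?thesis
      using i by (auto simp: remaining_def preferred_def stage_def)
  next
    case False
    then obtain i where i: "v = 2 * i + 1"
      by (rule oddE)
    have "in_arcs (chain n) v = {(2 * i, 2 * i + 1)}"
      using i v by (auto simp: in_arcs_chain parcs_chain) presburger
    moreover have "out_arcs (chain n) v = {(v, v + 1)}"
      using i v by (auto simp: in_arcs_chain parcs_chain)
    ultimately show ?thesis
      using i by (auto simp: remaining_def preferred_def stage_def)
  qed
qed

section \<open>Correspondence between s-t paths and sets of stages\<close>

lemma set_chain_path:
  "e \<in> set (chain_path b 0 n P) \<longleftrightarrow> e \<in> parcs (chain n) \<and> preferred b e = (stage e \<in> P)"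
proof (cases e)
  case (Pair u v)
  show ?thesis
  proof
    assume "e \<in> set (chain_path b 0 n P)"
    then show "e \<in> parcs (chain n) \<and> preferred b e = (stage e \<in> P)"
      by (auto simp: chain_path_def stage_route_def parcs_chain preferred_def stage_def
          split: if_splits)
  next
    assume e: "e \<in> parcs (chain n) \<and> preferred b e = (stage e \<in> P)"
    have "e \<in> set (stage_route ((stage e \<in> P) = b) (stage e))"
      using e Pair
      by (cases "even u")
        (auto simp: parcs_chain preferred_def stage_def stage_route_def elim!: evenE oddE)
    moreover have "stage e < n"
      using e stage_less by blast
    ultimately show "e \<in> set (chain_path b 0 n P)"
      by (auto simp: chain_path_def)
  qed
qed

lemma chain_path_rec:
  "i < n \<Longrightarrow> chain_path b i n P = stage_route ((i \<in> P) = b) i @ chain_path b (Suc i) n P"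
  by (simp add: chain_path_def upt_conv_Cons)

lemma chain_path_end [simp]: "chain_path b n n P = []"
  by (simp add: chain_path_def)

lemma chain_path_cong:
  "(\<And>j. i \<le> j \<Longrightarrow> j < n \<Longrightarrow> j \<in> P \<longleftrightarrow> j \<in> Q) \<Longrightarrow> chain_path b i n P = chain_path b i n Q"
  unfolding chain_path_def by (intro arg_cong[where f = concat] map_cong) auto

text \<open>A detour has two arcs and a direct arc has one. So each stage in \<open>P\<close>
  lengthens the path by one if \<open>b\<close> holds and shortens it by one otherwise: a larger
  \<open>P\<close> is better for either heuristic.\<close>

lemma length_chain_path:
  assumes "P \<subseteq> {..<n}"
  shows "length (chain_path b 0 n P) = (if b then n + card P else 2 * n - card P)"
proof -
  have fin: "finite P"
    using assms finite_subset by blast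
  have "length (chain_path b 0 n P) = (\<Sum>j<n. if (j \<in> P) = b then 2 else 1)"
    by (simp add: chain_path_def length_concat comp_def stage_route_def sum_list_sum_nth
        atLeast0LessThan if_distrib numeral_2_eq_2 cong: if_cong)
  also have "\<dots> = (\<Sum>j\<in>P. if b then 2 else 1) + (\<Sum>j\<in>{..<n} - P. if b then 1 else 2)"
    using assms by (subst sum.subset_diff[of P]) (auto intro!: arg_cong2[where f = "(+)"] sum.cong)
  also have "\<dots> = (if b then n + card P else 2 * n - card P)"
    using assms card_mono[OF _ assms] by (simp add: card_Diff_subset fin diff_mult_distrib mult.commute[of n])
  finally show ?thesis .
qed

lemma pcas_chain_path: "i \<le> n \<Longrightarrow> pcas (2 * i) (chain_path b i n P) (2 * n)"
  by (induction i rule: inc_induct) (auto simp: chain_path_rec stage_route_def)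

text \<open>Vertices strictly increase along such a walk; the induction also carries the lower bound
  \<open>u\<close> on all of them.\<close>

lemma distinct_pawalk_verts:
  assumes "\<forall>(u, v) \<in> set p. u < (v :: nat)" "pcas u p v"
  shows "distinct (pawalk_verts u p)"
proof -
  have "distinct (pawalk_verts u p) \<and> (\<forall>x \<in> set (pawalk_verts u p). u \<le> x)"
    using assms by (induction p arbitrary: u) fastforce+
  then show ?thesis ..
qed

lemma st_path_iff: "st_path G s t p \<longleftrightarrow>
    s \<in> pverts G \<and> set p \<subseteq> parcs G \<and> pcas s p t \<and> distinct (pawalk_verts s p)"
  by (simp add: pre_digraph.apath_def pre_digraph.awalk_def cas_with_proj_eq
      awalk_verts_with_proj_eq)

lemma st_path_chain_path: "st_path (chain n) 0 (2 * n) (chain_path b 0 n P)"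
proof -
  have sub: "set (chain_path b 0 n P) \<subseteq> parcs (chain n)"
    by (auto simp: set_chain_path)
  then have "\<forall>(u, v) \<in> set (chain_path b 0 n P). u < v"
    by (auto simp: parcs_chain dest!: subsetD)
  then show ?thesis
    using sub pcas_chain_path[of 0 n b P] distinct_pawalk_verts
    by (auto simp: st_path_iff pverts_chain)
qed

text \<open>A walk chooses freely only at even vertices, once per stage, because an odd vertex has a
  single outgoing arc. Downward induction on \<open>i\<close> peels off one stage at a time.\<close>

lemma chain_walk_eq_chain_path:
  assumes "i \<le> n" "set p \<subseteq> parcs (chain n)" "pcas (2 * i) p (2 * n)"
  shows "\<exists>P. p = chain_path b i n P"
  using assms
proof (induction i arbitrary: p rule: inc_induct)
  case base
  then have "p = []"
    by (cases p) (auto simp: parcs_chain)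
  then show ?case by simp
next
  case (step i)
  have "\<exists>d q. p = stage_route d i @ q \<and> set q \<subseteq> parcs (chain n) \<and> pcas (2 * Suc i) q (2 * n)"
  proof (cases p)
    case Nil
    with step show ?thesis by simp
  next
    case (Cons e p')
    then consider "e = (2 * i, 2 * i + 2)" | "e = (2 * i, 2 * i + 1)"
      using step.prems by (cases e) (auto simp: parcs_chain)
    then show ?thesis
    proof cases
      case 1
      then have "p = stage_route False i @ p'"
        by (simp add: Cons stage_route_def)
      with 1 Cons step.prems show ?thesis
        by (intro exI[of _ False] exI[of _ p']) auto
    next
      case 2
      with Cons step.prems have p': "pcas (2 * i + 1) p' (2 * n)" "set p' \<subseteq> parcs (chain n)"
        by auto
      \<comment> \<open>By parity the walk cannot end in the middle of a detour.\<close>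
      moreover have "2 * i + 1 \<noteq> 2 * n"
        by presburger
      ultimately obtain f q where "p' = f # q"
        by (cases p') auto
      with p' have "p' = (2 * i + 1, 2 * i + 2) # q"
        by (cases f) (auto simp: parcs_chain)
      with 2 Cons step.prems show ?thesis
        by (intro exI[of _ True] exI[of _ q]) (auto simp: stage_route_def)
    qed
  qed
  then obtain d q where q: "p = stage_route d i @ q" "set q \<subseteq> parcs (chain n)"
      "pcas (2 * Suc i) q (2 * n)"
    by blast
  then obtain P where P: "q = chain_path b (Suc i) n P"
    using step.IH by blast
  \<comment> \<open>Only membership of \<open>i\<close> is adjusted; the tail looks at stages from
    \<open>Suc i\<close> on and stays the same.\<close>
  define Q where "Q = (if d = b then insert i P else P - {i})"
  have "p = chain_path b i n Q"
    using q(1) P step.hyps chain_path_cong[of "Suc i" n P Q b]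
    by (auto simp: chain_path_rec Q_def)
  then show ?case ..
qed

lemma st_path_chainE:
  assumes "st_path (chain n) 0 (2 * n) p"
  obtains P where "P \<subseteq> {..<n}" "p = chain_path b 0 n P"
proof -
  have "\<exists>P. p = chain_path b 0 n P"
    using assms by (intro chain_walk_eq_chain_path) (auto simp: st_path_iff)
  then obtain P where "p = chain_path b 0 n P" ..
  \<comment> \<open>Cutting \<open>P\<close> down to actual stages makes its cardinality meaningful
    for the length formula.\<close>
  moreover have "chain_path b 0 n P = chain_path b 0 n (P \<inter> {..<n})"
    by (rule chain_path_cong) auto
  ultimately show thesis
    using that[of "P \<inter> {..<n}"] by auto
qed

section \<open>A single round of the heuristic\<close>

lemma ex_arc_of_stage:
  assumes "j < n"
  obtains e where "e \<in> parcs (chain n)" "stage e = j" "preferred b e = d"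
proof (cases "d = b")
  case True
  then show thesis
    using assms that[of "(2 * j, Suc (2 * j))"] by (auto simp: parcs_chain stage_def preferred_def)
next
  case False
  then show thesis
    using assms that[of "(2 * j, 2 * j + 2)"] by (auto simp: parcs_chain stage_def preferred_def)
qed

text \<open>While \<open>r < n\<close> all non-preferred routes are still positive, so the only
  obstacles are the exhausted preferred routes of the stages \<open>j \<le> r\<close>.\<close>

lemma positive_chain_path_iff:
  assumes Y: "\<forall>e \<in> parcs (chain n). Y e = remaining b n r e" and "r < n" and P: "P \<subseteq> {..<n}"
  shows "positive_path (chain n) 0 (2 * n) Y (chain_path b 0 n P) \<longleftrightarrow> P \<subseteq> {r<..<n}"
proof
  assume pos: "positive_path (chain n) 0 (2 * n) Y (chain_path b 0 n P)"
  show "P \<subseteq> {r<..<n}"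
  proof
    fix j assume j: "j \<in> P"
    with P obtain e where e: "e \<in> parcs (chain n)" "stage e = j" "preferred b e"
      using ex_arc_of_stage[of j n b True] by blast
    with j have "e \<in> set (chain_path b 0 n P)"
      by (simp add: set_chain_path)
    with pos have "0 < Y e"
      by (simp add: positive_path_def)
    with e Y have "r < j"
      by (simp add: remaining_def)
    with P j show "j \<in> {r<..<n}" by auto
  qed
next
  assume "P \<subseteq> {r<..<n}"
  moreover note stage_less
  ultimately show "positive_path (chain n) 0 (2 * n) Y (chain_path b 0 n P)"
    using \<open>r < n\<close> Y
    by (auto simp: positive_path_def st_path_chain_path set_chain_path remaining_def)
qed

definition length_choice :: "bool \<Rightarrow> ((nat \<times> nat) list \<Rightarrow> bool) \<Rightarrow> (nat \<times> nat) list \<Rightarrow> bool" where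
  "length_choice b = (if b then is_arg_max length else is_arg_min length)"

text \<open>Length is strictly monotone in the number of preferred stages, so the full set of
  admissible stages is the unique optimum and ties never arise.\<close>

lemma length_choice_iff:
  assumes Y: "\<forall>e \<in> parcs (chain n). Y e = remaining b n r e" and "r < n"
  shows "length_choice b (positive_path (chain n) 0 (2 * n) Y) p \<longleftrightarrow> p = chain_path b 0 n {r<..<n}"
proof -
  let ?pos = "positive_path (chain n) 0 (2 * n) Y" and ?S = "{r<..<n}"
  have S: "?pos (chain_path b 0 n ?S)"
    using positive_chain_path_iff[OF assms, of ?S] by fastforce
  have better: "if b then length q < length (chain_path b 0 n ?S)
      else length (chain_path b 0 n ?S) < length q"
    if pos: "?pos q" and ne: "q \<noteq> chain_path b 0 n ?S" for q
  proof -
    from pos have "st_path (chain n) 0 (2 * n) q"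
      by (simp add: positive_path_def)
    then obtain P where P: "P \<subseteq> {..<n}" "q = chain_path b 0 n P"
      by (rule st_path_chainE)
    then have "P \<subset> ?S"
      using positive_chain_path_iff[OF assms, of P] pos ne by auto
    then have "card P < card ?S"
      by (intro psubset_card_mono) auto
    \<comment> \<open>The bound keeps the truncated subtraction in \<open>2 * n - card P\<close>
      strictly monotone.\<close>
    moreover have "card ?S \<le> n" "?S \<subseteq> {..<n}"
      by auto
    ultimately show ?thesis
      using length_chain_path[of P n b] length_chain_path[of ?S n b] P by (auto simp del: card_greaterThanLessThan)
  qed
  show ?thesis
  proof (cases b)
    case True
    with S better show ?thesis
      by (simp add: length_choice_def is_arg_max_def) (metis order_less_asym)
  next
    case False
    with S better show ?thesis
      by (simp add: length_choice_def is_arg_min_def) (metis order_less_asym)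
  qed
qed

lemma Min_chain_path:
  assumes Y: "\<forall>e \<in> parcs (chain n). Y e = remaining b n r e" and "r < n"
  shows "Min (Y ` set (chain_path b 0 n {r<..<n})) = 1"
proof (rule Min_eqI)
  have "positive_path (chain n) 0 (2 * n) Y (chain_path b 0 n {r<..<n})"
    using positive_chain_path_iff[OF assms, of "{r<..<n}"] by fastforce
  then show "1 \<le> y" if "y \<in> Y ` set (chain_path b 0 n {r<..<n})" for y
    using that by (force simp: positive_path_def)
  show "1 \<in> Y ` set (chain_path b 0 n {r<..<n})"
  proof (cases "Suc r < n")
    case True
    then obtain e where "e \<in> parcs (chain n)" "stage e = Suc r" "preferred b e"
      using ex_arc_of_stage[of "Suc r" n b True] by blast
    with True Y show ?thesis
      by (intro image_eqI[of _ _ e]) (auto simp: set_chain_path remaining_def)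
  next
    \<comment> \<open>Last round, \<open>r = n - 1\<close>: no preferred route is left, and the
      bottleneck is a non-preferred route carrying \<open>n - r = 1\<close>.\<close>
    case False
    obtain e where "e \<in> parcs (chain n)" "stage e = r" "\<not> preferred b e"
      using ex_arc_of_stage[of r n b False] \<open>r < n\<close> by blast
    with False \<open>r < n\<close> Y show ?thesis
      by (intro image_eqI[of _ _ e]) (auto simp: set_chain_path remaining_def)
  qed
qed simp

text \<open>Stages \<open>j > r\<close> lose a unit on the preferred route, \<open>j - r\<close>
  becoming \<open>j - Suc r\<close>; stages \<open>j \<le> r\<close> lose it on the other one,
  \<open>n - r\<close> becoming \<open>n - Suc r\<close>.\<close>

lemma remaining_step:
  assumes Y: "\<forall>e \<in> parcs (chain n). Y e = remaining b n r e"
  shows "\<forall>e \<in> parcs (chain n).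
    Y e - 1 * path_flow (chain_path b 0 n {r<..<n}) e = remaining b n (Suc r) e"
proof
  fix e assume e: "e \<in> parcs (chain n)"
  then have "stage e < n"
    by (rule stage_less)
  with e Y show "Y e - 1 * path_flow (chain_path b 0 n {r<..<n}) e = remaining b n (Suc r) e"
    by (auto simp: path_flow_def set_chain_path remaining_def max_def)
qed

section \<open>Complete runs of the heuristic\<close>

lemma remaining_zero_iff:
  assumes Y: "\<forall>e \<in> parcs (chain n). Y e = remaining b n r e" and "r \<le> n"
  shows "(\<forall>e \<in> parcs (chain n). Y e = 0) \<longleftrightarrow> r = n"
proof
  assume zero: "\<forall>e \<in> parcs (chain n). Y e = 0"
  show "r = n"
  proof (rule ccontr)
    assume "r \<noteq> n"
    \<comment> \<open>The other route of stage \<open>r\<close> still carries \<open>n - r\<close>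
      units.\<close>
    with \<open>r \<le> n\<close> obtain e where "e \<in> parcs (chain n)" "stage e = r" "\<not> preferred b e"
      using ex_arc_of_stage[of r n b False] by (metis le_neq_implies_less)
    with zero Y \<open>r \<noteq> n\<close> \<open>r \<le> n\<close> show False
      by (auto simp: remaining_def)
  qed
next
  assume "r = n"
  moreover note stage_less
  ultimately show "\<forall>e \<in> parcs (chain n). Y e = 0"
    using Y by (auto simp: remaining_def max_def dest: order_less_imp_le)
qed

text \<open>Each round is forced and advances \<open>r\<close> by one, so all runs have the same
  length. Agreement of \<open>Y\<close> with \<open>remaining\<close> is assumed on arcs only, since
  values elsewhere are arbitrary.\<close>

lemma length_greedy_run:
  assumes "greedy_run (length_choice b) (chain n) 0 (2 * n) Y D"
    and "\<forall>e \<in> parcs (chain n). Y e = remaining b n r e" "r \<le> n"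
  shows "length D = n - r"
  using assms
proof (induction Y D arbitrary: r rule: greedy_run.induct)
  case (finish Y)
  then show ?case
    using remaining_zero_iff[of n Y b r] by simp
next
  case (step Y p w D)
  then have "r < n"
    using remaining_zero_iff[of n Y b r] by auto
  with step have p: "p = chain_path b 0 n {r<..<n}"
    using length_choice_iff[of n Y b r] by blast
  with step \<open>r < n\<close> have w: "w = 1"
    using Min_chain_path[of n Y b r] by simp
  have "length D = n - Suc r"
    using step.prems \<open>r < n\<close> remaining_step[of n Y b r] by (intro step.IH) (simp_all add: p w)
  then show ?case
    using \<open>r < n\<close> by simp
qed

text \<open>Ensures that the bound on all runs is not vacuous.\<close>

lemma ex_greedy_run:
  assumes "r \<le> n" "\<forall>e \<in> parcs (chain n). Y e = remaining b n r e"
  shows "\<exists>D. greedy_run (length_choice b) (chain n) 0 (2 * n) Y D"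
  using assms
proof (induction r arbitrary: Y rule: inc_induct)
  case base
  then show ?case
    using remaining_zero_iff[of n Y b n] by (blast intro: greedy_run.finish)
next
  case (step r)
  let ?p = "chain_path b 0 n {r<..<n}"
  obtain D where D: "greedy_run (length_choice b) (chain n) 0 (2 * n) (\<lambda>e. Y e - 1 * path_flow ?p e) D"
    using step.IH[OF remaining_step[OF step.prems]] by blast
  have "greedy_run (length_choice b) (chain n) 0 (2 * n) Y ((1, ?p) # D)"
  proof (rule greedy_run.step[OF _ _ _ D])
    show "\<exists>e \<in> parcs (chain n). Y e \<noteq> 0"
      using step remaining_zero_iff[of n Y b r] by auto
  qed (use step length_choice_iff[of n Y b r] Min_chain_path[of n Y b r] in auto)
  then show ?case ..
qed

section \<open>A small decomposition from binary digits\<close>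

lemma sum_bits:
  assumes "j < 2 ^ k"
  shows "(\<Sum>i<k. if bit j i then 2 ^ i else 0) = (j :: nat)"
proof -
  have "(\<Sum>i<k. if bit j i then 2 ^ i else 0) = take_bit k j"
    unfolding take_bit_sum atLeast0LessThan by (intro sum.cong) (auto simp: push_bit_eq_mult)
  with assms show ?thesis
    by (simp add: take_bit_nat_eq_self)
qed

text \<open>Set and unset bits together contribute all powers below \<open>2 ^ k\<close>, that is
  \<open>2 ^ k - 1\<close>.\<close>

lemma sum_not_bits:
  assumes "j < 2 ^ k"
  shows "(\<Sum>i<k. if bit j i then 0 else 2 ^ i) = 2 ^ k - 1 - (j :: nat)"
proof -
  have "(\<Sum>i<k. if bit j i then 2 ^ i else 0) + (\<Sum>i<k. if bit j i then 0 else 2 ^ i)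
      = (\<Sum>i<k. 2 ^ i :: nat)"
    unfolding sum.distrib[symmetric] by (intro sum.cong) auto
  also have "\<dots> = 2 ^ k - 1"
    using mask_eq_sum_exp_nat[of k] by (simp add: lessThan_def)
  finally show ?thesis
    using sum_bits[OF assms] by simp
qed

lemma mfd_chain_le:
  assumes "n = 2 ^ k - 1"
  shows "mfd (chain n) 0 (2 * n) (remaining b n 0) \<le> k"
proof -
  \<comment> \<open>Path \<open>i\<close> takes the preferred route exactly in the stages whose bit
    \<open>i\<close> is set. The set is infinite, but only its members below \<open>n\<close> affect
    the path.\<close>
  define D where "D = map (\<lambda>i. (2 ^ i :: nat, chain_path b 0 n {j. bit j i})) [0..<k]"
  have "remaining b n 0 e = (\<Sum>(w, p) \<leftarrow> D. w * path_flow p e)" if e: "e \<in> parcs (chain n)" for e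
  proof -
    have j: "stage e < 2 ^ k"
      using stage_less[OF e] assms by simp
    have "(\<Sum>(w, p) \<leftarrow> D. w * path_flow p e)
        = (\<Sum>i<k. if preferred b e = bit (stage e) i then 2 ^ i else 0)"
      using e by (simp add: D_def comp_def sum_list_sum_nth atLeast0LessThan path_flow_def
          set_chain_path if_distrib cong: if_cong)
    also have "\<dots> = remaining b n 0 e"
    proof (cases "preferred b e")
      case True
      then show ?thesis
        using sum_bits[OF j] by (simp add: remaining_def)
    next
      case False
      then have "(\<Sum>i<k. if preferred b e = bit (stage e) i then 2 ^ i else 0)
          = (\<Sum>i<k. if bit (stage e) i then 0 else 2 ^ i :: nat)"
        by (intro sum.cong) auto
      with False show ?thesis
        using sum_not_bits[OF j] assms by (simp add: remaining_def)
    qed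
    finally show ?thesis ..
  qed
  then have "flow_decomposition (chain n) 0 (2 * n) (remaining b n 0) D"
    by (auto simp: flow_decomposition_def D_def st_path_chain_path)
  moreover have "length D = k"
    by (simp add: D_def)
  ultimately show ?thesis
    unfolding mfd_def by (blast intro: Least_le)
qed

section \<open>The approximation ratio and the family of instances\<close>

lemma chain_ratio:
  assumes "0 < k" "n = 2 ^ k - 1" "d \<le> k"
  shows "ln 2 / 3 * (real (3 * n) / ln (real (3 * n))) * real d \<le> real n"
proof -
  \<comment> \<open>This amounts to \<open>3 \<le> 2 * 2 ^ k\<close>, which needs
    \<open>0 < k\<close>.\<close>
  have n: "2 ^ k \<le> 3 * n"
    using assms power_increasing[of 1 k "2 :: nat"] by simp
  then have "real k * ln 2 \<le> ln (real (3 * n))"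
    by (metis ln_le_cancel_iff ln_realpow numeral_power_le_of_nat_cancel_iff of_nat_0_less_iff
        order_less_le_trans zero_less_numeral zero_less_power)
  moreover have "real d * ln 2 \<le> real k * ln 2"
    using assms by simp
  ultimately have "real d * ln 2 \<le> ln (real (3 * n))"
    by linarith
  moreover have "0 < ln (real (3 * n))"
  proof -
    have "1 < 3 * n"
      using n assms(1) one_less_power[of "2 :: nat" k] by linarith
    then show ?thesis
      by (intro ln_gt_zero) linarith
  qed
  \<comment> \<open>With \<open>m = 3 * n\<close> arcs, \<open>d * ln 2 \<le> ln m\<close>; the
    factor \<open>ln 2\<close> and \<open>n = m / 3\<close> yield the constant
    \<open>ln 2 / 3\<close>.\<close>
  ultimately have "real n * (real d * ln 2 / ln (real (3 * n))) \<le> real n * 1"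
    by (intro mult_left_mono) simp_all
  then show ?thesis
    by (simp add: mult_ac)
qed

lemma chain_instances:
  fixes greedy
  assumes greedy: "greedy = greedy_run (length_choice b)"
  shows "\<exists>(c::real) (C::real)
       (F :: (nat pair_pre_digraph \<times> nat \<times> nat \<times> (nat \<times> nat \<Rightarrow> nat)) set).
      c > 0 \<and> C > 0 \<and>
      (\<forall>N::nat. \<exists>(G, s, t, X) \<in> F. card (parcs G) \<ge> N) \<and>
      (\<forall>(G, s, t, X) \<in> F.
         st_dag G s t \<and> flow G s t X \<and> (\<exists>e \<in> parcs G. X e \<noteq> 0) \<and>
         card (parcs G) \<ge> 2 \<and>
         real (card (parcs G)) \<le> C * real (card (pverts G)) \<and>
         (\<exists>D. greedy G s t X D) \<and>
         (\<forall>D. greedy G s t X D \<longrightarrow>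
            real (length D) \<ge>
              c * (real (card (parcs G)) / ln (real (card (parcs G)))) * real (mfd G s t X)))"
proof -
  define I where "I k = (chain (2 ^ k - 1), 0 :: nat, 2 * (2 ^ k - 1) :: nat,
      remaining b (2 ^ k - 1) 0)" for k :: nat
  have "\<exists>(G, s, t, X) \<in> I ` {0<..}. card (parcs G) \<ge> N" for N
  proof -
    have "N \<le> 3 * (2 ^ Suc N - 1)"
      using less_exp[of "Suc N"] by simp
    then show ?thesis
      by (intro bexI[of _ "I (Suc N)"] imageI) (simp_all add: I_def card_parcs_chain)
  qed
  moreover have "st_dag G s t \<and> flow G s t X \<and> (\<exists>e \<in> parcs G. X e \<noteq> 0) \<and>
         card (parcs G) \<ge> 2 \<and>
         real (card (parcs G)) \<le> 2 * real (card (pverts G)) \<and>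
         (\<exists>D. greedy G s t X D) \<and>
         (\<forall>D. greedy G s t X D \<longrightarrow>
            real (length D) \<ge>
              ln 2 / 3 * (real (card (parcs G)) / ln (real (card (parcs G)))) * real (mfd G s t X))"
    if "0 < k" and I: "I k = (G, s, t, X)" for k G s t X
  proof -
    define n :: nat where "n = 2 ^ k - 1"
    have eqs: "G = chain n" "s = 0" "t = 2 * n" "X = remaining b n 0"
      using I by (simp_all add: I_def n_def)
    have n: "0 < n"
      using \<open>0 < k\<close> one_less_power[of "2 :: nat" k] by (simp add: n_def)
    have "length D = n" if "greedy G s t X D" for D
      using length_greedy_run[of b n X D 0] that by (simp add: eqs greedy)
    moreover have "\<exists>e \<in> parcs G. X e \<noteq> 0"
      using remaining_zero_iff[of n X b 0] n by (auto simp: eqs)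
    moreover have "\<exists>D. greedy G s t X D"
      using ex_greedy_run[of 0 n X b] by (simp add: eqs greedy)
    ultimately show ?thesis
      using n st_dag_chain[OF n] flow_chain[of n b]
        chain_ratio[OF \<open>0 < k\<close> n_def mfd_chain_le[OF n_def]]
      by (simp add: eqs card_parcs_chain pverts_chain)
  qed
  ultimately show ?thesis
    \<comment> \<open>Sparsity holds with constant 2 because
      \<open>3 * n \<le> 2 * (2 * n + 1)\<close>; \<open>k = 0\<close> is left out as it gives a
      chain without arcs.\<close>
    by (intro exI[of _ "ln 2 / 3"] exI[of _ 2] exI[of _ "I ` {0<..}"]) auto
qed

theorem mainTheorem2:
  shows "\<forall>greedy \<in> {greedy_longest, greedy_shortest}.
    \<exists>(c::real) (C::real)
       (F :: (nat pair_pre_digraph \<times> nat \<times> nat \<times> (nat \<times> nat \<Rightarrow> nat)) set).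
      c > 0 \<and> C > 0 \<and>
      (\<forall>N::nat. \<exists>(G, s, t, X) \<in> F. card (parcs G) \<ge> N) \<and>
      (\<forall>(G, s, t, X) \<in> F.
         st_dag G s t \<and> flow G s t X \<and> (\<exists>e \<in> parcs G. X e \<noteq> 0) \<and>
         card (parcs G) \<ge> 2 \<and>
         real (card (parcs G)) \<le> C * real (card (pverts G)) \<and>
         (\<exists>D. greedy G s t X D) \<and>
         (\<forall>D. greedy G s t X D \<longrightarrow>
            real (length D) \<ge>
              c * (real (card (parcs G)) / ln (real (card (parcs G)))) * real (mfd G s t X)))"
  using chain_instances[of greedy_longest True] chain_instances[of greedy_shortest False]
  by (simp add: greedy_longest_def greedy_shortest_def length_choice_def)

end
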